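(* Let $b\ge 2$ and $N\ge 1$ be integers and let $\alpha_N(j,k)$, $0\le j,k\le b^N-1$, denote the $(j,k)$-entry of the matrix $S_{b,N}(x)$. Then \[ \alpha_N(j,k)=\begin{cases} \binom{x+d_0-1}{d_0} \binom{x+d_1-1}{d_1} \cdots \binom{x+d_{N-1}-1}{d_{N-1}}, & \text{if } 0\leq k\leq j \leq b^N-1 \text{ and } k \preceq j, \\ 0, & \text{otherwise}, \end{cases} \] where, for $j\ge k$, $j-k=d_0b^0+d_1b^1+\cdots+d_{N-1}b^{N-1}$ is the base-$b$ expansion of $j-k$ (digits $0\le d_i\le b-1$).
   Context: For a variable $z$ and non-negative integer $d$, $\binom{z}{d}=z(z-1)\cdots(z-d+1)/d!$. Rows and columns of matrices are indexed from $0$. $S_{b,1}(x)$ is the $b\times b$ lower-triangular matrix whose $(j,k)$-entry is $\binom{x+j-k-1}{j-k}$ if $0\le k\le j\le b-1$ and $0$ otherwise; for $N\ge1$, $S_{b,N+1}(x)=S_{b,1}(x)\otimes S_{b,N}(x)$, where $\otimes$ is the Kronecker product, so $S_{b,N}(x)$ has size $b^N\times b^N$. Digital dominance: for $0\le k,j\le b^N-1$, $k\preceq j$ means that every base-$b$ digit of $k$ is at most the corresponding base-$b$ digit of $j$. *)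

theory Defs
  imports Complex_Main "Jordan_Normal_Form.Matrix"
begin

definition kronecker :: "'a::semiring_0 mat \<Rightarrow> 'a mat \<Rightarrow> 'a mat"  (infixr "\<otimes>\<^sub>K" 70) where
  "A \<otimes>\<^sub>K B = mat (dim_row A * dim_row B) (dim_col A * dim_col B)
     (\<lambda>(j, k). A $$ (j div dim_row B, k div dim_col B) * B $$ (j mod dim_row B, k mod dim_col B))"

definition S1 :: "nat \<Rightarrow> 'a::field_char_0 \<Rightarrow> 'a mat" where
  "S1 b x = mat b b (\<lambda>(j, k).
     if k \<le> j then (x + of_nat j - of_nat k - 1) gchoose (j - k) else 0)"


text \<open>Only \<open>N \<ge> 1\<close> is meant; the equation for \<open>N = 0\<close> is a dummy value. Taking \<open>x\<close> in an
  arbitrary field of characteristic 0 covers an indeterminate as well (e.g. in a field of formal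
  Laurent series).\<close>

fun S :: "nat \<Rightarrow> nat \<Rightarrow> 'a::field_char_0 \<Rightarrow> 'a mat" where
  "S b 0 x = 1\<^sub>m 1"
| "S b (Suc 0) x = S1 b x"
| "S b (Suc (Suc n)) x = S1 b x \<otimes>\<^sub>K S b (Suc n) x"

lemma S_carrier: "S b N x \<in> carrier_mat (b ^ N) (b ^ N)"
  by (induction b N x rule: S.induct) (auto simp: S1_def kronecker_def)

definition digit :: "nat \<Rightarrow> nat \<Rightarrow> nat \<Rightarrow> nat" where
  "digit b n i = n div b ^ i mod b"

lemma digit_less: "b > 0 \<Longrightarrow> digit b n i < b"
  by (simp add: digit_def)

lemma digit_expansion: "n < b ^ N \<Longrightarrow> n = (\<Sum>i<N. digit b n i * b ^ i)"
proof (induction N arbitrary: n)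
  case (Suc N)
  have "n div b < b ^ N"
    using Suc.prems by (simp add: less_mult_imp_div_less mult.commute)
  from Suc.IH[OF this] have "n div b = (\<Sum>i<N. digit b (n div b) i * b ^ i)" .
  moreover have "digit b (n div b) i = digit b n (Suc i)" for i
    by (simp add: digit_def div_mult2_eq)
  ultimately have "b * (n div b) = (\<Sum>i<N. digit b n (Suc i) * b ^ Suc i)"
    by (simp add: sum_distrib_left mult.left_commute)
  moreover have "n = n mod b + b * (n div b)"
    by simp
  ultimately show ?case
    by (simp add: sum.lessThan_Suc_shift digit_def del: sum.lessThan_Suc)
qed simp

lemma digit_unique:
  assumes "\<And>i. i < N \<Longrightarrow> d i < b" and "i < N"
  shows "digit b (\<Sum>i<N. d i * b ^ i) i = d i"
  using assms
proof (induction N arbitrary: d i)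
  case (Suc N)
  have b: "d 0 < b" using Suc.prems by simp
  have eq: "(\<Sum>i<Suc N. d i * b ^ i) = d 0 + b * (\<Sum>i<N. d (Suc i) * b ^ i)"
    by (simp add: sum.lessThan_Suc_shift sum_distrib_left mult.left_commute del: sum.lessThan_Suc)
  show ?case
  proof (cases i)
    case 0
    then show ?thesis unfolding eq using b by (simp add: digit_def)
  next
    case (Suc m)
    have "(d 0 + b * (\<Sum>i<N. d (Suc i) * b ^ i)) div b = (\<Sum>i<N. d (Suc i) * b ^ i)"
      using b by simp
    then have "digit b (\<Sum>i<Suc N. d i * b ^ i) i = digit b (\<Sum>i<N. d (Suc i) * b ^ i) m"
      unfolding eq Suc by (simp add: digit_def div_mult2_eq)
    also have "\<dots> = d (Suc m)"
      using Suc.IH[of "\<lambda>i. d (Suc i)" m] Suc.prems Suc by simp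
    finally show ?thesis by (simp add: Suc)
  qed
qed simp

definition digit_le :: "nat \<Rightarrow> nat \<Rightarrow> nat \<Rightarrow> bool" where
  "digit_le b k j \<longleftrightarrow> (\<forall>i. digit b k i \<le> digit b j i)"

end

theory Submission
  imports Defs
begin

text \<open>The Kronecker product splits off the leading digits of the two indices, so the entry of
  \<open>S b N x\<close> at \<open>(j, k)\<close> is the product of the entries of \<open>S1 b x\<close> at the pairs of corresponding
  digits. Such a product vanishes unless \<open>k\<close> is digitally dominated by \<open>j\<close>, and in that case
  \<open>j - k\<close> is computed without borrows, so its digits are the differences of the digits.\<close>

lemma digit_mod_power:
  assumes "i < N"
  shows "digit b (n mod b ^ N) i = digit b n i"
proof -
  \<comment> \<open>Factoring \<open>b ^ i\<close> out of the modulus splits off the digits below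
    position \<open>i\<close>; since \<open>i < N\<close>, a factor \<open>b\<close> remains in the
    cofactor, so the final reduction mod \<open>b\<close> is unaffected.\<close>
  have "b ^ N = b ^ i * (b * b ^ (N - Suc i))"
    using assms by (simp flip: power_Suc power_add)
  then have "n mod b ^ N = b ^ i * (n div b ^ i mod (b * b ^ (N - Suc i))) + n mod b ^ i"
    by (simp add: mod_mult2_eq)
  then show ?thesis
    by (cases "b = 0") (simp_all add: digit_def mod_mod_cancel)
qed

lemma digit_top:
  assumes "n < b ^ Suc N"
  shows "digit b n N = n div b ^ N"
  using assms by (simp add: digit_def less_mult_imp_div_less)

lemma S_entry_eq_prod:
  assumes "N \<ge> 1" "j < b ^ N" "k < b ^ N"
  shows "S b N x $$ (j, k) = (\<Prod>i<N. S1 b x $$ (digit b j i, digit b k i))"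
  using assms
proof (induction N arbitrary: j k rule: nat_induct_at_least)
  case base
  then show ?case by (simp add: digit_def)
next
  case (Suc N)
  from Suc.prems have "b > 0" by (cases "b = 0") simp_all
  have dims: "dim_row (S1 b x) = b" "dim_col (S1 b x) = b"
    "dim_row (S b N x) = b ^ N" "dim_col (S b N x) = b ^ N"
    using S_carrier[of b N x] by (auto simp: S1_def)
  \<comment> \<open>The recursive equation of \<open>S\<close> applies only from size 2 on, so
    \<open>N \<ge> 1\<close> is used to expose a successor and avoid the dummy value at 0.\<close>
  have "S b (Suc N) x = S1 b x \<otimes>\<^sub>K S b N x"
    using Suc.hyps by (cases N) auto
  then have "S b (Suc N) x $$ (j, k) =
      S1 b x $$ (j div b ^ N, k div b ^ N) * S b N x $$ (j mod b ^ N, k mod b ^ N)"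
    using Suc.prems by (simp add: kronecker_def dims)
  also have "S b N x $$ (j mod b ^ N, k mod b ^ N) =
      (\<Prod>i<N. S1 b x $$ (digit b j i, digit b k i))"
    using \<open>b > 0\<close> by (simp add: Suc.IH digit_mod_power)
  finally show ?case
    by (simp add: digit_top[OF Suc.prems(1)] digit_top[OF Suc.prems(2)] mult.commute)
qed

lemma digit_eq_0:
  assumes "n < b ^ N" "N \<le> i"
  shows "digit b n i = 0"
proof (cases "b = 0")
  case False
  then have "b ^ N \<le> b ^ i"
    using assms by (intro power_increasing) auto
  then show ?thesis using assms by (simp add: digit_def)
\<comment> \<open>For \<open>b = 0\<close> the bound \<open>n < 0 ^ N\<close> forces
  \<open>N = 0\<close> and \<open>n = 0\<close>.\<close>
qed (use assms in \<open>cases N; simp add: digit_def\<close>)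

text \<open>Beyond position \<open>N\<close> all digits of \<open>k\<close> vanish. This places a
  failure of dominance among the \<open>N\<close> factors of the entry.\<close>

lemma digit_le_iff:
  assumes "k < b ^ N"
  shows "digit_le b k j \<longleftrightarrow> (\<forall>i<N. digit b k i \<le> digit b j i)"
  unfolding digit_le_def using digit_eq_0[OF assms] by (metis le0 not_le)

lemma digit_le_imp_le:
  assumes "digit_le b k j" "j < b ^ N" "k < b ^ N"
  shows "k \<le> j"
proof -
  have "(\<Sum>i<N. digit b k i * b ^ i) \<le> (\<Sum>i<N. digit b j i * b ^ i)"
    using assms(1) by (intro sum_mono) (simp add: digit_le_def)
  then show ?thesis
    using digit_expansion[OF assms(2)] digit_expansion[OF assms(3)] by simp
qed

lemma digit_diff:
  assumes "digit_le b k j" "j < b ^ N" "k < b ^ N" "b > 0" "i < N"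
  shows "digit b (j - k) i = digit b j i - digit b k i"
proof -
  have "j - k = (\<Sum>i<N. digit b j i * b ^ i) - (\<Sum>i<N. digit b k i * b ^ i)"
    using digit_expansion[OF assms(2)] digit_expansion[OF assms(3)] by simp
  \<comment> \<open>Dominance makes every truncated difference exact, so subtraction can be done
    termwise.\<close>
  also have "\<dots> = (\<Sum>i<N. (digit b j i - digit b k i) * b ^ i)"
    using assms(1) by (simp add: sum_subtractf_nat diff_mult_distrib digit_le_def)
  finally have "j - k = (\<Sum>i<N. (digit b j i - digit b k i) * b ^ i)" .
  \<comment> \<open>The coefficients are thus genuine digits, and uniqueness of the expansion
    applies.\<close>
  moreover have "digit b j i - digit b k i < b" for i
    using digit_less[OF \<open>b > 0\<close>, of j i] by simp
  ultimately show ?thesis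
    using digit_unique[of N "\<lambda>i. digit b j i - digit b k i" b i] \<open>i < N\<close> by simp
qed

theorem theorem2p2:
  fixes b N j k :: nat and x :: "'a::field_char_0"
  assumes "b \<ge> 2" and "N \<ge> 1" and "j < b ^ N" and "k < b ^ N"
  shows "S b N x $$ (j, k) =
    (if k \<le> j \<and> digit_le b k j
     then (\<Prod>i<N. (x + of_nat (digit b (j - k) i) - 1) gchoose digit b (j - k) i)
     else 0)"
proof -
  have "b > 0" using assms by simp
  note entry = S_entry_eq_prod[OF assms(2-4), of x]
  have S1_digit: "S1 b x $$ (digit b j i, digit b k i) =
      (if digit b k i \<le> digit b j i
       then (x + of_nat (digit b j i) - of_nat (digit b k i) - 1)
              gchoose (digit b j i - digit b k i) else 0)" for i
    using \<open>b > 0\<close> by (simp add: S1_def digit_less)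
  show ?thesis
  proof (cases "digit_le b k j")
    case True
    then have le: "digit b k i \<le> digit b j i" for i
      by (simp add: digit_le_def)
    \<comment> \<open>By dominance, \<open>of_nat\<close> commutes with the digit difference, which
      is the digit of \<open>j - k\<close>.\<close>
    have "S1 b x $$ (digit b j i, digit b k i) =
        (x + of_nat (digit b (j - k) i) - 1) gchoose digit b (j - k) i" if "i < N" for i
      using digit_diff[OF True assms(3,4) \<open>b > 0\<close> that] le[of i]
      by (simp add: S1_digit of_nat_diff add_diff_eq)
    then show ?thesis
      using True digit_le_imp_le[OF True assms(3,4)] by (simp add: entry)
  next
    case False
    then obtain i where "i < N" "\<not> digit b k i \<le> digit b j i"
      using digit_le_iff[OF assms(4)] by blast
    \<comment> \<open>The violating position gives an entry of \<open>S1 b x\<close> above the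
      diagonal, a zero factor.\<close>
    then have "S b N x $$ (j, k) = 0"
      unfolding entry by (intro prod_zero) (auto simp: S1_digit)
    then show ?thesis using False by simp
  qed
qed

end
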